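(* For every real $q>0$ and every pattern $\sigma\in\mathcal{S}_m$ ($m\ge1$), the limit $$\rho(\sigma,q):=\lim_{n\to\infty} P_n(\sigma,q)^{1/n}$$ exists.
   Context: $\mathcal{S}_n$ is the set of permutations of $[n]$. For $q>0$, the Mallows distribution with parameter $q$ on $\mathcal{S}_n$ assigns probability $q^{\operatorname{inv}(\pi)}/[n]_q!$ to each $\pi\in\mathcal{S}_n$, where $\operatorname{inv}(\pi)$ is the number of pairs $i<j$ with $\pi_i>\pi_j$, $[n]_q=1+q+\dots+q^{n-1}$ and $[n]_q!=[1]_q\cdots[n]_q$. A permutation $\pi\in\mathcal{S}_n$ avoids $\sigma\in\mathcal{S}_m$ (consecutively) if there is no $j\in[n-m+1]$ with $\operatorname{st}(\pi_j\dots\pi_{j+m-1})=\sigma$, where $\operatorname{st}$ replaces a list of distinct integers by the order-isomorphic permutation. $P_n(\sigma,q)$ is the probability that a Mallows($q$) random permutation of length $n$ avoids $\sigma$. *)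

theory Defs
  imports "HOL-Probability.Probability" "HOL-Combinatorics.Multiset_Permutations"
begin

text \<open>
  A permutation of \<open>{1..n}\<close> is given in one-line notation, as an element of
  \<^term>\<open>permutations_of_set {1..n}\<close>. List positions start at \<open>0\<close>.
\<close>

definition inv_count :: "nat list \<Rightarrow> nat" where
  "inv_count \<pi> = card {(i, j). i < j \<and> j < length \<pi> \<and> \<pi> ! i > \<pi> ! j}"

definition q_int :: "real \<Rightarrow> nat \<Rightarrow> real" where
  "q_int q n = (\<Sum>k<n. q ^ k)"

definition q_fact :: "real \<Rightarrow> nat \<Rightarrow> real" where
  "q_fact q n = (\<Prod>k=1..n. q_int q k)"

definition mallows :: "real \<Rightarrow> nat \<Rightarrow> nat list measure" where
  "mallows q n = point_measure (permutations_of_set {1..n})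
     (\<lambda>\<pi>. ennreal (q ^ inv_count \<pi> / q_fact q n))"

definition standardize :: "nat list \<Rightarrow> nat list" where
  "standardize xs = map (\<lambda>x. card {y \<in> set xs. y \<le> x}) xs"

lemma length_standardize [simp]: "length (standardize xs) = length xs"
  by (simp add: standardize_def)

lemma standardize_order_iso:
  assumes "i < length xs" "j < length xs"
  shows "standardize xs ! i < standardize xs ! j \<longleftrightarrow> xs ! i < xs ! j"
proof -
  have mono: "card {y \<in> set xs. y \<le> a} \<le> card {y \<in> set xs. y \<le> b}" if "a \<le> b" for a b
    using that by (intro card_mono) auto
  have smono: "card {y \<in> set xs. y \<le> a} < card {y \<in> set xs. y \<le> b}"
    if "a < b" "b \<in> set xs" for a b
  proof (intro psubset_card_mono psubsetI)
    show "{y \<in> set xs. y \<le> a} \<noteq> {y \<in> set xs. y \<le> b}"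
      using that by (metis (mono_tags, lifting) leD mem_Collect_eq order_refl)
  qed (use that in auto)
  show ?thesis
    using assms mono[of "xs ! j" "xs ! i"] smono[of "xs ! i" "xs ! j"]
    by (force simp: standardize_def not_less)
qed

lemma standardize_permutation:
  assumes "distinct xs"
  shows "standardize xs \<in> permutations_of_set {1..length xs}"
proof -
  have d: "distinct (standardize xs)"
    unfolding distinct_conv_nth
  proof (intro allI impI)
    fix i j assume ij: "i < length (standardize xs)" "j < length (standardize xs)" "i \<noteq> j"
    then have "xs ! i \<noteq> xs ! j"
      using assms by (simp add: nth_eq_iff_index_eq)
    then show "standardize xs ! i \<noteq> standardize xs ! j"
      using standardize_order_iso[of i xs j] standardize_order_iso[of j xs i] ij by auto
  qed
  have "set (standardize xs) \<subseteq> {1..length xs}"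
  proof
    fix r assume "r \<in> set (standardize xs)"
    then obtain x where x: "x \<in> set xs" and r: "r = card {y \<in> set xs. y \<le> x}"
      by (auto simp: standardize_def)
    have "card {y \<in> set xs. y \<le> x} \<le> card (set xs)"
      by (intro card_mono) auto
    moreover have "card {y \<in> set xs. y \<le> x} > 0"
      using x by (auto simp: card_gt_0_iff)
    ultimately show "r \<in> {1..length xs}"
      using r card_length[of xs] by simp
  qed
  moreover have "card (set (standardize xs)) = card {1..length xs}"
    using d by (simp add: distinct_card)
  ultimately have "set (standardize xs) = {1..length xs}"
    by (simp add: card_subset_eq)
  with d show ?thesis
    by (simp add: permutations_of_set_def)
qed

definition avoids :: "nat list \<Rightarrow> nat list \<Rightarrow> bool" where
  "avoids \<pi> \<sigma> \<longleftrightarrow>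
     \<not> (\<exists>j. j + length \<sigma> \<le> length \<pi> \<and> standardize (take (length \<sigma>) (drop j \<pi>)) = \<sigma>)"

definition avoid_prob :: "nat \<Rightarrow> nat list \<Rightarrow> real \<Rightarrow> real" where
  "avoid_prob n \<sigma> q = measure (mallows q n) {\<pi> \<in> permutations_of_set {1..n}. avoids \<pi> \<sigma>}"

end

theory Submission
  imports Defs
begin

text \<open>
  Cutting a permutation of \<open>[m + n]\<close> after its first \<open>m\<close> letters gives the set of these letters
  and two independent Mallows permutations (after standardization), because the number of
  inversions between the two blocks depends on the set only. As both blocks of an avoiding
  permutation avoid \<open>\<sigma>\<close>, the avoidance probabilities are submultiplicative, and Fekete's
  argument applies.
\<close>

section \<open>Inversions of a concatenation\<close>

lemma inv_count_append:
  "inv_count (xs @ ys) = inv_count xs + inv_count ys +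
     card {(i, j). i < length xs \<and> j < length ys \<and> xs ! i > ys ! j}"
proof -
  let ?L = "length xs"
  \<comment> \<open>Inversions are sorted by the cut: both positions on its left (\<open>X\<close>),
    both on its right (\<open>Y\<close>), one on each side (\<open>Z\<close>). \<open>f\<close> and
    \<open>g\<close> translate block positions into positions of \<open>xs @ ys\<close>, so
    \<open>g\<close> shifts only the second one.\<close>
  define X where "X = {(i, j). i < j \<and> j < ?L \<and> xs ! i > xs ! j}"
  define Y where "Y = {(i, j). i < j \<and> j < length ys \<and> ys ! i > ys ! j}"
  define Z where "Z = {(i, j). i < ?L \<and> j < length ys \<and> xs ! i > ys ! j}"
  define f where "f = (\<lambda>(i, j). (i + ?L, j + ?L))"
  define g where "g = (\<lambda>(i, j). (i :: nat, j + ?L))"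
  have fin: "finite X" "finite Y" "finite Z"
    by (rule finite_subset[of _ "{..?L} \<times> {..?L}"], auto simp: X_def)
       (rule finite_subset[of _ "{..length ys} \<times> {..length ys}"], auto simp: Y_def,
        rule finite_subset[of _ "{..?L} \<times> {..length ys}"], auto simp: Z_def)
  have eq: "{(i, j). i < j \<and> j < length (xs @ ys) \<and> (xs @ ys) ! i > (xs @ ys) ! j}
      = X \<union> f ` Y \<union> g ` Z" (is "?A = ?B")
  proof
    show "?A \<subseteq> ?B"
    proof clarify
      fix i j assume *: "i < j" "j < length (xs @ ys)" "(xs @ ys) ! j < (xs @ ys) ! i"
        and nZ: "(i, j) \<notin> g ` Z" and nY: "(i, j) \<notin> f ` Y"
      show "(i, j) \<in> X"
      proof (rule ccontr)
        assume nX: "(i, j) \<notin> X"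
        with * have j: "j \<ge> ?L" by (auto simp: X_def nth_append split: if_splits)
        show False
        proof (cases "i < ?L")
          case True
          with * j have "(i, j - ?L) \<in> Z" by (auto simp: Z_def nth_append)
          moreover have "(i, j) = g (i, j - ?L)" using j by (simp add: g_def)
          ultimately show False using nZ by blast
        next
          case False
          with * j have "(i - ?L, j - ?L) \<in> Y" by (auto simp: Y_def nth_append)
          moreover have "(i, j) = f (i - ?L, j - ?L)" using j False by (simp add: f_def)
          ultimately show False using nY by blast
        qed
      qed
    qed
    show "?B \<subseteq> ?A"
      by (auto simp: X_def Y_def Z_def f_def g_def nth_append)
  qed
  have "card (X \<union> f ` Y \<union> g ` Z) = card (X \<union> f ` Y) + card (g ` Z)"
    using fin by (intro card_Un_disjoint) (auto simp: X_def Y_def Z_def f_def g_def)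
  also have "card (X \<union> f ` Y) = card X + card (f ` Y)"
    using fin by (intro card_Un_disjoint) (auto simp: X_def Y_def Z_def f_def g_def)
  also have "card (f ` Y) = card Y" by (rule card_image) (auto simp: f_def inj_on_def)
  also have "card (g ` Z) = card Z" by (rule card_image) (auto simp: g_def inj_on_def)
  finally show ?thesis
    unfolding inv_count_def eq by (simp add: X_def Y_def Z_def)
qed

definition cross_inv :: "nat set \<Rightarrow> nat set \<Rightarrow> nat" where
  "cross_inv A B = card {(a, b). a \<in> A \<and> b \<in> B \<and> b < a}"

text \<open>Distinctness makes positions and letters correspond one to one, so inversions across the
  cut can be counted as pairs of letters. The order within each block then no longer enters that
  count.\<close>

lemma inv_count_append_distinct:
  assumes "distinct xs" "distinct ys"
  shows "inv_count (xs @ ys) = inv_count xs + inv_count ys + cross_inv (set xs) (set ys)"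
proof -
  let ?Z = "{(i, j). i < length xs \<and> j < length ys \<and> xs ! i > ys ! j}"
  let ?h = "\<lambda>(i, j). (xs ! i, ys ! j)"
  have "{(a, b). a \<in> set xs \<and> b \<in> set ys \<and> b < a} = ?h ` ?Z"
    by (force simp: in_set_conv_nth image_iff)
  moreover have "inj_on ?h ?Z"
    using assms by (auto simp: inj_on_def nth_eq_iff_index_eq)
  ultimately have "cross_inv (set xs) (set ys) = card ?Z"
    by (simp add: cross_inv_def card_image)
  then show ?thesis by (simp add: inv_count_append)
qed

section \<open>Invariance under increasing relabelling\<close>

lemma inv_count_map:
  assumes "strict_mono_on A f" "set xs \<subseteq> A"
  shows "inv_count (map f xs) = inv_count xs"
proof -
  have "{(i, j). i < j \<and> j < length (map f xs) \<and> map f xs ! i > map f xs ! j}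
      = {(i, j). i < j \<and> j < length xs \<and> xs ! i > xs ! j}"
    using strict_mono_on_less[OF assms(1)] assms(2)
    by (auto simp: subset_iff)
  then show ?thesis by (simp add: inv_count_def)
qed

lemma standardize_map:
  assumes "strict_mono_on A f" "set xs \<subseteq> A"
  shows "standardize (map f xs) = standardize xs"
proof -
  have inj: "inj_on f A" using assms(1) by (rule strict_mono_on_imp_inj_on)
  have "card {y \<in> f ` set xs. y \<le> f x} = card {y \<in> set xs. y \<le> x}" if "x \<in> set xs" for x
  proof -
    have "{y \<in> f ` set xs. y \<le> f x} = f ` {y \<in> set xs. y \<le> x}"
      using strict_mono_on_less_eq[OF assms(1)] assms(2) that by (auto simp: subset_iff)
    moreover have "inj_on f {y \<in> set xs. y \<le> x}"
      using inj assms(2) by (auto intro: inj_on_subset)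
    ultimately show ?thesis by (simp add: card_image)
  qed
  then show ?thesis by (simp add: standardize_def)
qed

lemma avoids_map:
  assumes "strict_mono_on A f" "set xs \<subseteq> A"
  shows "avoids (map f xs) \<sigma> \<longleftrightarrow> avoids xs \<sigma>"
proof -
  have "standardize (take k (drop j (map f xs))) = standardize (take k (drop j xs))" for j k
    using standardize_map[OF assms(1), of "take k (drop j xs)"] assms(2)
    by (metis (no_types, lifting) drop_map order_trans set_drop_subset set_take_subset take_map)
  then show ?thesis by (simp add: avoids_def)
qed

text \<open>Every window of a block is a window of the whole list. The converse can fail, since an
  occurrence of the pattern may straddle the cut; hence submultiplicativity only, and not
  equality.\<close>

lemma avoids_appendD:
  assumes "avoids (xs @ ys) \<sigma>"
  shows "avoids xs \<sigma>" and "avoids ys \<sigma>"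
proof -
  have *: "standardize (take (length \<sigma>) (drop j (xs @ ys))) \<noteq> \<sigma>"
    if "j + length \<sigma> \<le> length xs + length ys" for j
    using assms that unfolding avoids_def by fastforce
  show "avoids xs \<sigma>"
    unfolding avoids_def
  proof clarify
    fix j assume "j + length \<sigma> \<le> length xs" "standardize (take (length \<sigma>) (drop j xs)) = \<sigma>"
    then show False using *[of j] by simp
  qed
  show "avoids ys \<sigma>"
    unfolding avoids_def
  proof clarify
    fix j assume "j + length \<sigma> \<le> length ys" "standardize (take (length \<sigma>) (drop j ys)) = \<sigma>"
    then show False using *[of "length xs + j"] by simp
  qed
qed

section \<open>Inversion generating functions and their factorization at a cut\<close>

definition inv_weight :: "real \<Rightarrow> (nat list \<Rightarrow> bool) \<Rightarrow> nat set \<Rightarrow> real" where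
  "inv_weight q P A = (\<Sum>xs | xs \<in> permutations_of_set A \<and> P xs. q ^ inv_count xs)"

text \<open>The blocks of a cut permutation use arbitrary letter sets. The rank map of
  \<open>A\<close> is an increasing bijection onto \<open>{1..card A}\<close>; it preserves
  inversions and, by the assumption on \<open>P\<close>, the restriction as well.\<close>

lemma inv_weight_standardize:
  assumes "finite A"
    and P: "\<And>f xs. strict_mono_on A f \<Longrightarrow> set xs = A \<Longrightarrow> P (map f xs) \<longleftrightarrow> P xs"
  shows "inv_weight q P A = inv_weight q P {1..card A}"
proof -
  define f where "f x = card {y \<in> A. y \<le> x}" for x
  have sm: "strict_mono_on A f"
  proof (rule strict_mono_onI)
    fix x y assume "x \<in> A" "y \<in> A" "x < y"
    then have "{z \<in> A. z \<le> x} \<subseteq> {z \<in> A. z \<le> y}" "y \<in> {z \<in> A. z \<le> y}" "y \<notin> {z \<in> A. z \<le> x}"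
      by auto
    then have "{z \<in> A. z \<le> x} \<subset> {z \<in> A. z \<le> y}" by blast
    then show "f x < f y"
      unfolding f_def using assms(1) by (intro psubset_card_mono) auto
  qed
  then have inj: "inj_on f A" by (rule strict_mono_on_imp_inj_on)
  have "f x \<in> {1..card A}" if "x \<in> A" for x
    using that assms(1) card_mono[of A "{y \<in> A. y \<le> x}"]
    by (auto simp: f_def Suc_le_eq card_gt_0_iff)
  then have fA: "f ` A = {1..card A}"
    using inj by (intro card_subset_eq) (auto simp: card_image)
  have eq: "{xs \<in> permutations_of_set {1..card A}. P xs}
      = map f ` {xs \<in> permutations_of_set A. P xs}"
    unfolding fA[symmetric] permutations_of_set_image_inj[OF inj]
    using P[OF sm] by (auto simp: permutations_of_set_def)
  have "inj_on (map f) {xs \<in> permutations_of_set A. P xs}"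
    using inj by (intro inj_on_subset[OF inj_on_mapI[of f "permutations_of_set A"]])
      (auto simp: permutations_of_set_def intro: inj_on_subset)
  then show ?thesis
    unfolding inv_weight_def eq
    by (subst sum.reindex) (auto intro!: sum.cong simp: inv_count_map[OF sm] permutations_of_set_def)
qed

text \<open>Cutting after \<open>k\<close> letters is a bijection onto triples of a
  \<open>k\<close>-subset, an arrangement of it and an arrangement of its complement. Since
  \<open>k\<close> is at most \<open>card S\<close>, the first block really has \<open>k\<close>
  letters.\<close>

lemma sum_permutations_of_set_split:
  fixes g :: "'a list \<Rightarrow> 'b :: comm_monoid_add"
  assumes "finite S" "k \<le> card S"
  shows "sum g (permutations_of_set S) =
    (\<Sum>A | A \<subseteq> S \<and> card A = k. \<Sum>xs\<in>permutations_of_set A. \<Sum>ys\<in>permutations_of_set (S - A).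
       g (xs @ ys))"
proof -
  let ?D = "SIGMA A : {A. A \<subseteq> S \<and> card A = k}. permutations_of_set A \<times> permutations_of_set (S - A)"
  have "sum g (permutations_of_set S) = (\<Sum>(A, xs, ys)\<in>?D. g (xs @ ys))"
  proof (rule sum.reindex_bij_witness[of _ "\<lambda>(A, xs, ys). xs @ ys"
        "\<lambda>zs. (set (take k zs), take k zs, drop k zs)"], goal_cases)
    case (2 zs)
    then have zs: "distinct zs" "set zs = S" by (auto simp: permutations_of_set_def)
    have "distinct (take k zs @ drop k zs)" using zs by simp
    then have dis: "set (take k zs) \<inter> set (drop k zs) = {}" by (simp only: distinct_append)
    have un: "set (take k zs) \<union> set (drop k zs) = S"
      using zs by (metis append_take_drop_id set_append)
    have "length zs = card S" using zs distinct_card[of zs] by simp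
    then have "card (set (take k zs)) = k"
      using zs assms(2) by (simp add: distinct_card)
    with zs dis un show ?case by (auto simp: permutations_of_set_def)
  next
    case (3 t)
    then show ?case
      by (auto simp: permutations_of_set_def distinct_card)
  next
    case (4 t)
    then show ?case by (auto simp: permutations_of_set_def)
  qed auto
  also have "\<dots> = (\<Sum>A | A \<subseteq> S \<and> card A = k. \<Sum>(xs, ys)\<in>permutations_of_set A \<times> permutations_of_set (S - A).
       g (xs @ ys))"
    using assms(1) by (subst sum.Sigma) (auto intro: finite_subset)
  finally show ?thesis by (simp add: sum.cartesian_product)
qed

text \<open>The Gaussian binomial coefficient, as the generating function of the subsets of size \<open>k\<close>.\<close>

definition cross_weight :: "real \<Rightarrow> nat \<Rightarrow> nat \<Rightarrow> real" where
  "cross_weight q k n = (\<Sum>A | A \<subseteq> {1..k + n} \<and> card A = k. q ^ cross_inv A ({1..k + n} - A))"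

text \<open>For a fixed set \<open>A\<close> of first letters the sum is a product, and relabelling
  makes its two block factors independent of \<open>A\<close>. Keeping \<open>P\<close> general
  serves both the avoidance weights and, with the trivial predicate, their normalization.\<close>

lemma inv_weight_split:
  assumes P: "\<And>A f xs. strict_mono_on A f \<Longrightarrow> set xs = A \<Longrightarrow> P (map f xs) \<longleftrightarrow> P xs"
  shows "(\<Sum>xs | xs \<in> permutations_of_set {1..k + n} \<and> P (take k xs) \<and> P (drop k xs). q ^ inv_count xs)
     = cross_weight q k n * (inv_weight q P {1..k} * inv_weight q P {1..n})"
proof -
  let ?S = "{1..k + n}"
  \<comment> \<open>As an indicator inside the weight, the restriction factors over the two
    blocks.\<close>
  let ?w = "\<lambda>xs. if P xs then q ^ inv_count xs else 0"
  have w: "inv_weight q P A = sum ?w (permutations_of_set A)" for A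
    by (simp add: inv_weight_def sum.inter_filter)
  have "(\<Sum>xs | xs \<in> permutations_of_set ?S \<and> P (take k xs) \<and> P (drop k xs). q ^ inv_count xs)
      = (\<Sum>xs\<in>permutations_of_set ?S. if P (take k xs) \<and> P (drop k xs) then q ^ inv_count xs else 0)"
    by (simp add: sum.inter_filter)
  also have "\<dots> = (\<Sum>A | A \<subseteq> ?S \<and> card A = k. \<Sum>xs\<in>permutations_of_set A.
      \<Sum>ys\<in>permutations_of_set (?S - A).
        if P (take k (xs @ ys)) \<and> P (drop k (xs @ ys)) then q ^ inv_count (xs @ ys) else 0)"
    by (rule sum_permutations_of_set_split) auto
  also have "\<dots> = (\<Sum>A | A \<subseteq> ?S \<and> card A = k. \<Sum>xs\<in>permutations_of_set A.
      \<Sum>ys\<in>permutations_of_set (?S - A). q ^ cross_inv A (?S - A) * (?w xs * ?w ys))"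
  proof (intro sum.cong refl)
    fix A xs ys assume A: "A \<in> {A. A \<subseteq> ?S \<and> card A = k}" "xs \<in> permutations_of_set A"
      "ys \<in> permutations_of_set (?S - A)"
    then have "set xs = A" "distinct xs" "set ys = ?S - A" "distinct ys" "length xs = k"
      by (auto simp: permutations_of_set_def distinct_card)
    then show "(if P (take k (xs @ ys)) \<and> P (drop k (xs @ ys)) then q ^ inv_count (xs @ ys) else 0)
        = q ^ cross_inv A (?S - A) * (?w xs * ?w ys)"
      by (simp add: inv_count_append_distinct power_add)
  qed
  also have "\<dots> = (\<Sum>A | A \<subseteq> ?S \<and> card A = k.
      q ^ cross_inv A (?S - A) * (inv_weight q P A * inv_weight q P (?S - A)))"
    unfolding w sum_product by (simp only: sum_distrib_left)
  also have "\<dots> = (\<Sum>A | A \<subseteq> ?S \<and> card A = k.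
      q ^ cross_inv A (?S - A) * (inv_weight q P {1..k} * inv_weight q P {1..n}))"
  proof (intro sum.cong refl)
    fix A assume "A \<in> {A. A \<subseteq> ?S \<and> card A = k}"
    then have A: "finite A" "card A = k" "A \<subseteq> ?S" by (auto intro: finite_subset)
    then have "card (?S - A) = n" by (simp add: card_Diff_subset)
    with A show "q ^ cross_inv A (?S - A) * (inv_weight q P A * inv_weight q P (?S - A))
        = q ^ cross_inv A (?S - A) * (inv_weight q P {1..k} * inv_weight q P {1..n})"
      using inv_weight_standardize[of A P q] inv_weight_standardize[of "?S - A" P q] P by simp
  qed
  finally show ?thesis by (simp add: cross_weight_def sum_distrib_right)
qed

section \<open>The q-factorial as an inversion generating function\<close>

lemma cross_weight_1: "cross_weight q 1 n = q_int q (Suc n)"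
proof -
  have "cross_weight q 1 n = (\<Sum>k<Suc n. q ^ cross_inv {Suc k} ({1..Suc n} - {Suc k}))"
    unfolding cross_weight_def
    by (rule sum.reindex_bij_witness[of _ "\<lambda>k. {Suc k}" "\<lambda>A. the_elem A - 1"])
       (auto simp: card_1_singleton_iff)
  also have "\<dots> = (\<Sum>k<Suc n. q ^ k)"
  proof (intro sum.cong refl)
    fix k assume "k \<in> {..<Suc n}"
    \<comment> \<open>A first letter \<open>Suc k\<close> is larger than exactly \<open>k\<close> of
      the remaining letters.\<close>
    then have "{(a, b). a \<in> {Suc k} \<and> b \<in> {1..Suc n} - {Suc k} \<and> b < a} = Pair (Suc k) ` {1..k}"
      by auto
    then show "q ^ cross_inv {Suc k} ({1..Suc n} - {Suc k}) = q ^ k"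
      by (simp only: cross_inv_def) (simp add: card_image inj_on_def)
  qed
  finally show ?thesis by (simp add: q_int_def)
qed

lemma inv_weight_True_add:
  "inv_weight q (\<lambda>_. True) {1..k + n} =
     cross_weight q k n * (inv_weight q (\<lambda>_. True) {1..k} * inv_weight q (\<lambda>_. True) {1..n})"
  using inv_weight_split[where P = "\<lambda>_. True"] by (simp add: inv_weight_def)

text \<open>Splitting off the first letter contributes the factor \<open>q_int q (Suc n)\<close>.
  This identifies the normalizing constant of the Mallows distribution with the total
  weight.\<close>

lemma inv_weight_True: "inv_weight q (\<lambda>_. True) {1..n} = q_fact q n"
proof (induction n)
  case 0
  show ?case by (simp add: inv_weight_def q_fact_def inv_count_def)
next
  case (Suc n)
  have "inv_weight q (\<lambda>_. True) {1..1} = 1"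
    by (simp add: inv_weight_def inv_count_def less_Suc_eq cong: conj_cong)
  then show ?case
    using inv_weight_True_add[of q 1 n] Suc cross_weight_1[of q n]
    by (simp add: q_fact_def)
qed

section \<open>Avoidance probabilities and their submultiplicativity\<close>

lemma q_int_pos:
  assumes "q > 0" "n > 0"
  shows "q_int q n > 0"
  using assms unfolding q_int_def by (intro sum_pos) auto

lemma q_fact_pos:
  assumes "q > 0"
  shows "q_fact q n > 0"
  unfolding q_fact_def using q_int_pos[OF assms] by (intro prod_pos) auto

text \<open>Replaces the measure by a quotient of finite sums, the form used from here on.
  Positivity of \<open>q\<close> makes the densities nonnegative, so \<open>ennreal\<close> does not
  truncate them.\<close>

lemma avoid_prob_eq:
  assumes "q > 0"
  shows "avoid_prob n \<sigma> q = inv_weight q (\<lambda>xs. avoids xs \<sigma>) {1..n} / q_fact q n"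
  unfolding avoid_prob_def mallows_def inv_weight_def
  using assms q_fact_pos[OF assms, of n]
  by (subst measure_point_measure_finite_if) (auto simp: sum_divide_distrib)

lemma avoid_prob_nonneg: "avoid_prob n \<sigma> q \<ge> 0"
  by (simp add: avoid_prob_def)

lemma avoid_prob_le_1:
  assumes "q > 0"
  shows "avoid_prob n \<sigma> q \<le> 1"
proof -
  have "inv_weight q (\<lambda>xs. avoids xs \<sigma>) {1..n} \<le> inv_weight q (\<lambda>_. True) {1..n}"
    unfolding inv_weight_def using assms by (intro sum_mono2) auto
  then show ?thesis
    using q_fact_pos[OF assms, of n] unfolding inv_weight_True by (simp add: avoid_prob_eq[OF assms])
qed

text \<open>Numerator and denominator acquire the same factor \<open>cross_weight q k n\<close>,
  which cancels.\<close>

lemma avoid_prob_submult: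
  assumes "q > 0"
  shows "avoid_prob (k + n) \<sigma> q \<le> avoid_prob k \<sigma> q * avoid_prob n \<sigma> q"
proof -
  let ?P = "\<lambda>xs. avoids xs \<sigma>"
  let ?W = "\<lambda>n. inv_weight q ?P {1..n}"
  have "?W (k + n) \<le> (\<Sum>xs | xs \<in> permutations_of_set {1..k + n} \<and> ?P (take k xs) \<and> ?P (drop k xs).
      q ^ inv_count xs)"
    unfolding inv_weight_def using assms avoids_appendD[of "take k xs" "drop k xs" \<sigma> for xs]
    by (intro sum_mono2) auto
  also have "\<dots> = cross_weight q k n * (?W k * ?W n)"
    by (rule inv_weight_split) (simp add: avoids_map)
  finally have W: "?W (k + n) \<le> cross_weight q k n * (?W k * ?W n)" .
  have F: "q_fact q (k + n) = cross_weight q k n * (q_fact q k * q_fact q n)"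
    using inv_weight_True_add[of q k n] by (simp only: inv_weight_True)
  have pos: "q_fact q k > 0" "q_fact q n > 0" "q_fact q (k + n) > 0"
    using q_fact_pos[OF assms] by auto
  \<comment> \<open>By \<open>F\<close>, a vanishing cross weight would make the positive number
    \<open>q_fact q (k + n)\<close> zero.\<close>
  then have C: "cross_weight q k n \<noteq> 0" using F by auto
  have "?W (k + n) / q_fact q (k + n) \<le> cross_weight q k n * (?W k * ?W n) / q_fact q (k + n)"
    using W pos by (intro divide_right_mono) auto
  also have "\<dots> = ?W k / q_fact q k * (?W n / q_fact q n)"
    using C pos by (simp add: F)
  finally show ?thesis by (simp add: avoid_prob_eq[OF assms])
qed

section \<open>Fekete's argument for n-th roots\<close>

lemma convergent_root_submultiplicative:
  fixes a :: "nat \<Rightarrow> real"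
  assumes nonneg: "\<And>n. 0 \<le> a n" and le_1: "\<And>n. a n \<le> 1"
    and submult: "\<And>k n. a (k + n) \<le> a k * a n"
  shows "convergent (\<lambda>n. root n (a n))"
proof -
  \<comment> \<open>The limit will be this infimum. Index 0 is left out because
    \<open>root 0 x = 0\<close> would pull it down to 0. Using roots instead of logarithms allows
    \<open>a n = 0\<close>.\<close>
  define L where "L = (INF n\<in>{1..}. root n (a n))"
  have bdd: "bdd_below ((\<lambda>n. root n (a n)) ` {1..})"
    using nonneg by (intro bdd_belowI[of _ 0]) auto
  have L_le: "L \<le> root n (a n)" if "n \<ge> 1" for n
    unfolding L_def using bdd that by (intro cINF_lower) auto
  \<comment> \<open>This will be used for division with remainder by \<open>k\<close>; the remainder
    costs nothing because \<open>a r\<close> is at most 1.\<close>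
  have mult: "a (d * k + r) \<le> a k ^ d" for d k r
  proof (induction d)
    case (Suc d)
    have "a (Suc d * k + r) \<le> a k * a (d * k + r)"
      using submult[of k "d * k + r"] by (simp add: add.assoc)
    also have "\<dots> \<le> a k * a k ^ d" using Suc nonneg by (intro mult_left_mono)
    finally show ?case by simp
  qed (simp add: le_1)
  have "(\<lambda>n. root n (a n)) \<longlonglongrightarrow> L"
  proof (rule order_tendstoI)
    fix u assume "u < L"
    then show "\<forall>\<^sub>F n in sequentially. u < root n (a n)"
      using L_le by (intro eventually_sequentiallyI[of 1]) (auto intro: less_le_trans)
  next
    fix u assume "L < u"
    then obtain k where k: "k \<ge> 1" "root k (a k) < u"
      unfolding L_def using bdd by (subst (asm) cINF_less_iff) auto
    \<comment> \<open>The number \<open>root k (a k)\<close> may be 0. The intermediate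
      \<open>c\<close> is a positive base for \<open>powr\<close> and still leaves room below
      \<open>u\<close>.\<close>
    then obtain c where c: "root k (a k) < c" "c < u" using dense by blast
    have c_pos: "c > 0" using c k nonneg[of k] by (smt (verit) real_root_ge_zero)
    have "a k = root k (a k) ^ k" using k nonneg by simp
    also have "\<dots> \<le> c ^ k" using c k nonneg by (intro power_mono) auto
    finally have ak: "a k \<le> c ^ k" .
    have bound: "root n (a n) \<le> c powr (real (k * (n div k)) / real n)" if "n \<ge> 1" for n
    proof -
      have "a n \<le> a k ^ (n div k)" using mult[of "n div k" k "n mod k"] by simp
      also have "\<dots> \<le> (c ^ k) ^ (n div k)" using ak nonneg by (intro power_mono)
      also have "\<dots> = c powr real (k * (n div k))"
        using c_pos by (simp only: powr_realpow power_mult)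
      finally have "root n (a n) \<le> root n (c powr real (k * (n div k)))"
        using that by simp
      also have "\<dots> = c powr (real (k * (n div k)) / real n)"
        using that c_pos by (simp add: root_powr_inverse powr_powr field_simps)
      finally show ?thesis .
    qed
    \<comment> \<open>The remainder \<open>n mod k\<close> is less than \<open>k\<close>, so the
      exponent lies between \<open>1 - k / n\<close> and 1.\<close>
    have "(\<lambda>n. real (k * (n div k)) / real n) \<longlonglongrightarrow> 1"
    proof (rule tendsto_sandwich[OF _ _ _ tendsto_const])
      show "\<forall>\<^sub>F n in sequentially. 1 - real k / real n \<le> real (k * (n div k)) / real n"
      proof (intro eventually_sequentiallyI[of 1])
        fix n :: nat assume n: "1 \<le> n"
        have "n = k * (n div k) + n mod k" by simp
        moreover have "n mod k < k" using k by simp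
        ultimately have "real n - real k \<le> real (k * (n div k))"
          by linarith
        then have "(real n - real k) / real n \<le> real (k * (n div k)) / real n"
          by (intro divide_right_mono) auto
        then show "1 - real k / real n \<le> real (k * (n div k)) / real n"
          using n by (simp add: diff_divide_distrib)
      qed
      show "\<forall>\<^sub>F n in sequentially. real (k * (n div k)) / real n \<le> 1"
        by (intro eventually_sequentiallyI[of 1])
           (simp del: of_nat_mult add: divide_le_eq_1)
      have "(\<lambda>n. 1 - real k / real n) \<longlonglongrightarrow> 1 - 0"
        by (intro tendsto_diff tendsto_const lim_const_over_n)
      then show "(\<lambda>n. 1 - real k / real n) \<longlonglongrightarrow> 1" by simp
    qed
    then have "(\<lambda>n. c powr (real (k * (n div k)) / real n)) \<longlonglongrightarrow> c powr 1"
      using c_pos by (intro tendsto_powr tendsto_const) auto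
    then have "\<forall>\<^sub>F n in sequentially. c powr (real (k * (n div k)) / real n) < u"
      using c c_pos by (intro order_tendstoD(2)) auto
    then show "\<forall>\<^sub>F n in sequentially. root n (a n) < u"
      using eventually_ge_at_top[of 1] by eventually_elim (use bound in \<open>auto intro: le_less_trans\<close>)
  qed
  then show ?thesis by (auto simp: convergent_def)
qed

theorem theorem3p1:
  fixes q :: real and m :: nat and \<sigma> :: "nat list"
  assumes "q > 0" and "m \<ge> 1" and "\<sigma> \<in> permutations_of_set {1..m}"
  shows "convergent (\<lambda>n. root n (avoid_prob n \<sigma> q))"
  using assms(1)
  by (intro convergent_root_submultiplicative avoid_prob_nonneg avoid_prob_le_1 avoid_prob_submult)

end
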